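(* For the task of in-context learning of degree-$p$ polynomials in $d$ variables, there exists a bilinear Transformer $\mathsf{TF}_{\mathrm{bilin}}$ with embedding dimension $\bar d=2d+1$ implementing block-coordinate descent over polynomial regression, so that for $\hat y^{(\ell)}:=Z^{(2\ell)}_{\mathsf{TF}_{\mathrm{bilin}}}[\bar d+1,n+1]$ we have $$\hat y^{(\ell)}=f(x_{\mathrm{query}};w^{(\ell)}),$$ where $w^{(\ell)}$ are iterates of block-coordinate descent started at $w^{(0)}=0$ on the loss $L(w)=\frac1{2n}\sum_{i=1}^n(f(x_i;w)+y_i)^2$, with step sizes $\eta^{(\ell)}$ and a sequence of feature subsets $b_\ell$ (of the set of monomials of degree at most $p$) that cycles through all polynomial features of degree at most $p$, where $b_\ell$ corresponds to the features contained in the output of the $\ell$-th bilinear layer.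
   Context: Degree-$p$ polynomial functions of $d$ variables: $f(x;w)=\sum_{p_1+\cdots+p_d\le p}w_{p_1,\dots,p_d}\,x[1]^{p_1}\cdots x[d]^{p_d}$. In the polynomial in-context learning task, $x_1,\dots,x_{n+1}\overset{i.i.d.}{\sim}\mathcal{N}(0,\mathbf{I}_d)$, the target function has i.i.d. standard normal coefficients, $y_i$ is the value of the target function at $x_i$, $x_{\mathrm{query}}=x_{n+1}$, and the prompt is $$Z=\begin{bmatrix}1&\cdots&1&1\\ x_1&\cdots&x_n&x_{n+1}\\ \mathbf{0}&\cdots&\mathbf{0}&\mathbf{0}\\ y_1&\cdots&y_n&0\end{bmatrix}\in\mathbb{R}^{(\bar d+1)\times(n+1)},$$ with $\bar d-d-1$ zero rows. Layers: $\mathsf{bilin}(Z)=Z+(\mathrm{diag}(\mathbf{W}_0,0)Z)\odot(\mathrm{diag}(\mathbf{W}_1,0)Z)$ with $\mathbf{W}_0,\mathbf{W}_1\in\mathbb{R}^{\bar d\times\bar d}$ and $\odot$ the entrywise product; $\mathsf{attn}(Z)=Z+\frac1n\mathbf{P}ZM(Z^\top\mathbf{Q}Z)$ with $\mathbf{P},\mathbf{Q}\in\mathbb{R}^{(\bar d+1)\times(\bar d+1)}$ and $M=\mathrm{diag}(\mathbf{I}_n,0)$. A bilinear Transformer with $2L$ layers: $Z^{(0)}=Z$, $Z^{(2\ell+1)}=\mathsf{bilin}(Z^{(2\ell)})$, $Z^{(2\ell+2)}=\mathsf{attn}(Z^{(2\ell+1)})$, $\ell=0,\dots,L-1$, each layer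 with its own weights. Block-coordinate descent with subsets $b_\ell$ and step sizes $\eta^{(\ell)}$: $w^{(\ell)}_j=w^{(\ell-1)}_j-\eta^{(\ell)}\,\partial_{w_j}L(w)|_{w=w^{(\ell-1)}}$ if $j\in b_\ell$, and $w^{(\ell)}_j=w^{(\ell-1)}_j$ if $j\notin b_\ell$. *)

theory Defs
  imports "HOL-Probability.Probability" "Jordan_Normal_Form.Matrix"
begin

no_notation Finite_Cartesian_Product.vec_nth (infixl "$" 90)

subsection \<open>Polynomials in \<open>d\<close> variables\<close>

text \<open>A monomial \<open>x[1]^p1 ... x[d]^pd\<close> is identified with its exponent list \<open>[p1, ..., pd]\<close>;
  coefficient vectors are functions on exponent lists, of which only the values on
  \<open>monomials d p\<close> are used.\<close>

definition monomials :: "nat \<Rightarrow> nat \<Rightarrow> nat list set" where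
  "monomials d p = {q. length q = d \<and> sum_list q \<le> p}"

definition monomial_val :: "nat list \<Rightarrow> real vec \<Rightarrow> real" where
  "monomial_val q x = (\<Prod>k<length q. (x $ k) ^ (q ! k))"

definition poly_fun :: "nat \<Rightarrow> nat \<Rightarrow> (nat list \<Rightarrow> real) \<Rightarrow> real vec \<Rightarrow> real" where
  "poly_fun d p w x = (\<Sum>q\<in>monomials d p. w q * monomial_val q x)"

subsection \<open>The in-context learning task\<close>

text \<open>Indices start at 0: the context points are \<open>x 0, ..., x (n - 1)\<close> and the query is \<open>x n\<close>.
  Likewise, the last row of a matrix with \<open>e + 1\<close> rows has index \<open>e\<close>.\<close>

definition prompt :: "nat \<Rightarrow> nat \<Rightarrow> nat \<Rightarrow> (nat \<Rightarrow> real vec) \<Rightarrow> (nat \<Rightarrow> real) \<Rightarrow> real mat" where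
  "prompt d e n x y = mat (e + 1) (n + 1) (\<lambda>(r, j).
     if r = 0 then 1
     else if r \<le> d then x j $ (r - 1)
     else if r < e then 0
     else if j < n then y j
     else 0)"

definition poly_prompt ::
  "nat \<Rightarrow> nat \<Rightarrow> nat \<Rightarrow> nat \<Rightarrow> (nat \<Rightarrow> real vec) \<Rightarrow> (nat list \<Rightarrow> real) \<Rightarrow> real mat" where
  "poly_prompt d p e n x c = prompt d e n x (\<lambda>i. poly_fun d p c (x i))"

text \<open>\<open>X i\<close> is the \<open>i\<close>-th input and \<open>C q\<close> the coefficient of the monomial \<open>q\<close> in the target
  function. That \<open>X 0, ..., X n\<close> are i.i.d. with law \<open>N(0, I_d)\<close>, that the coefficients are
  i.i.d. standard normal, and that the target is independent of the inputs, is expressed by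
  saying that all coordinates and coefficients together form an independent family of standard
  normal variables.\<close>

definition poly_icl_task ::
  "'a measure \<Rightarrow> nat \<Rightarrow> nat \<Rightarrow> nat \<Rightarrow> (nat \<Rightarrow> 'a \<Rightarrow> real vec) \<Rightarrow> (nat list \<Rightarrow> 'a \<Rightarrow> real) \<Rightarrow> bool" where
  "poly_icl_task M d p n X C \<longleftrightarrow>
     prob_space M \<and>
     (\<forall>i\<le>n. \<forall>\<omega>\<in>space M. X i \<omega> \<in> carrier_vec d) \<and>
     (\<forall>i\<le>n. \<forall>k<d. distributed M lborel (\<lambda>\<omega>. X i \<omega> $ k) (\<lambda>t. ennreal (std_normal_density t))) \<and>
     (\<forall>q\<in>monomials d p. distributed M lborel (C q) (\<lambda>t. ennreal (std_normal_density t))) \<and>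
     prob_space.indep_vars M (\<lambda>_. borel) (case_sum (\<lambda>(i, k) \<omega>. X i \<omega> $ k) C)
       (({..n} \<times> {..<d}) <+> monomials d p)"

subsection \<open>Bilinear Transformers\<close>

definition hadamard :: "real mat \<Rightarrow> real mat \<Rightarrow> real mat" where
  "hadamard A B = mat (dim_row A) (dim_col A) (\<lambda>(i, j). A $$ (i, j) * B $$ (i, j))"

definition bilin :: "real mat \<Rightarrow> real mat \<Rightarrow> real mat \<Rightarrow> real mat" where
  "bilin W0 W1 Z =
     Z + hadamard (diag_block_mat [W0, 0\<^sub>m 1 1] * Z) (diag_block_mat [W1, 0\<^sub>m 1 1] * Z)"

definition attn :: "nat \<Rightarrow> real mat \<Rightarrow> real mat \<Rightarrow> real mat \<Rightarrow> real mat" where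
  "attn n P Q Z =
     Z + (1 / real n) \<cdot>\<^sub>m
       (P * Z * diag_block_mat [1\<^sub>m n, 0\<^sub>m 1 1] * (transpose_mat Z * Q * Z))"

text \<open>The weights of one bilinear layer followed by one attention layer.\<close>

record tf_block =
  blk_W0 :: "real mat"
  blk_W1 :: "real mat"
  blk_P :: "real mat"
  blk_Q :: "real mat"

text \<open>\<open>e\<close> is the embedding dimension; a list of \<open>L\<close> blocks is a Transformer with \<open>2 * L\<close> layers.\<close>

definition bilinear_transformer :: "nat \<Rightarrow> nat \<Rightarrow> tf_block list \<Rightarrow> bool" where
  "bilinear_transformer e L TF \<longleftrightarrow>
     length TF = L \<and>
     (\<forall>B\<in>set TF.
        blk_W0 B \<in> carrier_mat e e \<and> blk_W1 B \<in> carrier_mat e e \<and>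
        blk_P B \<in> carrier_mat (e + 1) (e + 1) \<and> blk_Q B \<in> carrier_mat (e + 1) (e + 1))"

text \<open>\<open>tf_state n TF Z k\<close> is the output \<open>Z^(k)\<close> of the \<open>k\<close>-th layer, for \<open>k \<le> 2 * length TF\<close>.\<close>

primrec tf_state :: "nat \<Rightarrow> tf_block list \<Rightarrow> real mat \<Rightarrow> nat \<Rightarrow> real mat" where
  "tf_state n TF Z 0 = Z"
| "tf_state n TF Z (Suc k) =
     (let B = TF ! (k div 2) in
      if even k then bilin (blk_W0 B) (blk_W1 B) (tf_state n TF Z k)
      else attn n (blk_P B) (blk_Q B) (tf_state n TF Z k))"

text \<open>The features contained in the output \<open>Z^(2 * l - 1)\<close> of the \<open>l\<close>-th bilinear layer
  (\<open>l \<ge> 1\<close>): the monomials of degree at most \<open>p\<close> that some row other than the label row carries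
  in every column (context and query), whatever the inputs and the target polynomial.\<close>

definition bilin_features ::
  "nat \<Rightarrow> nat \<Rightarrow> nat \<Rightarrow> nat \<Rightarrow> tf_block list \<Rightarrow> nat \<Rightarrow> nat list set" where
  "bilin_features d p e n TF l =
     {q \<in> monomials d p. \<exists>r<e. \<forall>x c. (\<forall>j\<le>n. x j \<in> carrier_vec d) \<longrightarrow>
        (\<forall>j\<le>n. tf_state n TF (poly_prompt d p e n x c) (2 * l - 1) $$ (r, j)
               = monomial_val q (x j))}"

subsection \<open>Block-coordinate descent\<close>

definition partial_deriv :: "(('i \<Rightarrow> real) \<Rightarrow> real) \<Rightarrow> 'i \<Rightarrow> ('i \<Rightarrow> real) \<Rightarrow> real" where
  "partial_deriv F j w = deriv (\<lambda>t. F (w(j := t))) (w j)"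

primrec bcd ::
  "(('i \<Rightarrow> real) \<Rightarrow> real) \<Rightarrow> (nat \<Rightarrow> real) \<Rightarrow> (nat \<Rightarrow> 'i set) \<Rightarrow> nat \<Rightarrow> 'i \<Rightarrow> real" where
  "bcd F \<eta> b 0 = (\<lambda>j. 0)"
| "bcd F \<eta> b (Suc l) =
     (\<lambda>j. if j \<in> b (Suc l)
          then bcd F \<eta> b l j - \<eta> (Suc l) * partial_deriv F j (bcd F \<eta> b l)
          else bcd F \<eta> b l j)"

text \<open>The sign in front of \<open>y i\<close> is intended: the iterates fit the negated labels.\<close>

definition icl_loss ::
  "nat \<Rightarrow> nat \<Rightarrow> nat \<Rightarrow> (nat \<Rightarrow> real vec) \<Rightarrow> (nat \<Rightarrow> real) \<Rightarrow> (nat list \<Rightarrow> real) \<Rightarrow> real" where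
  "icl_loss d p n x y w = 1 / (2 * real n) * (\<Sum>i<n. (poly_fun d p w (x i) + y i)\<^sup>2)"

text \<open>A sequence of subsets \<open>b 1, b 2, ...\<close> of \<open>S\<close> that repeats periodically and whose members
  over one period cover \<open>S\<close>.\<close>

definition cycles_through :: "(nat \<Rightarrow> 'i set) \<Rightarrow> 'i set \<Rightarrow> bool" where
  "cycles_through b S \<longleftrightarrow>
     (\<exists>T>0. (\<forall>l\<ge>1. b (l + T) = b l) \<and> (\<Union>l\<in>{1..T}. b l) = S)"

end

theory Submission
  imports Defs
begin

text \<open>One spare row suffices. A bilinear layer can reset it to 1 or multiply it by a coordinate,
  so its content can follow a closed walk through all monomials of degree at most \<open>p\<close>. The
  attention layer acts on the label row only: with \<open>Q\<close> equal to \<open>-\<eta>\<close> on the diagonal at one row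
  per available feature, it adds the change of \<open>f(x; w)\<close> under a gradient step in those
  coordinates, since the label row holds the residuals \<open>f(x_i; w) + y_i\<close> on the context and
  \<open>f(x_query; w)\<close> at the query.\<close>

section \<open>Exponent lists and walks through the monomials\<close>

definition incr :: "nat list \<Rightarrow> nat \<Rightarrow> nat list" where
  "incr q j = q[j := Suc (q ! j)]"

lemma length_incr [simp]: "length (incr q j) = length q"
  by (simp add: incr_def)

lemma finite_monomials: "finite (monomials d p)"
proof (rule finite_subset)
  show "monomials d p \<subseteq> {q. set q \<subseteq> {..p} \<and> length q = d}"
    using member_le_sum_list by (force simp: monomials_def)
  show "finite {q. set q \<subseteq> {..p} \<and> length q = d}"
    by (rule finite_lists_length_eq) simp
qed

lemma replicate_in_monomials: "replicate d 0 \<in> monomials d p"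
  by (simp add: monomials_def sum_list_replicate)

lemma monomial_val_replicate_0 [simp]: "monomial_val (replicate d 0) x = 1"
  by (simp add: monomial_val_def)

lemma monomial_val_incr:
  assumes "j < length q"
  shows "monomial_val (incr q j) x = monomial_val q x * x $ j"
proof -
  have "(\<Prod>k\<in>{..<length q} - {j}. (x $ k) ^ (incr q j ! k))
      = (\<Prod>k\<in>{..<length q} - {j}. (x $ k) ^ (q ! k))"
    by (rule prod.cong) (auto simp: incr_def)
  moreover have "incr q j ! j = Suc (q ! j)"
    using assms by (simp add: incr_def)
  ultimately show ?thesis
    using assms by (simp add: monomial_val_def prod.remove[of _ j])
qed

text \<open>Evaluating at the point with \<open>k\<close>-th coordinate 2 and all others 1 reads off the
  \<open>k\<close>-th exponent.\<close>

lemma monomial_val_inject: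
  assumes "length q = d" "length q' = d"
    and eq: "\<And>x. x \<in> carrier_vec d \<Longrightarrow> monomial_val q x = monomial_val q' x"
  shows "q = q'"
proof (rule nth_equalityI)
  fix k assume "k < length q"
  then have k: "k < d" using assms by simp
  define x :: "real vec" where "x = vec d (\<lambda>i. if i = k then 2 else 1)"
  have val: "monomial_val r x = 2 ^ (r ! k)" if "length r = d" for r
  proof -
    have "monomial_val r x = (\<Prod>i<d. if i = k then 2 ^ (r ! i) else 1)"
      unfolding monomial_val_def that by (rule prod.cong) (auto simp: x_def)
    then show ?thesis using k by (simp add: prod.delta)
  qed
  show "q ! k = q' ! k"
    using eq[of x] val[of q] val[of q'] assms(1,2) by (simp add: x_def carrier_vecI)
qed (use assms in simp)

text \<open>These are the two register updates that one bilinear layer can make: a reset to the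
  constant monomial, possible from anywhere, or multiplication by one coordinate. The degree bound
  is left to the walk.\<close>

definition monomial_step :: "nat \<Rightarrow> nat list \<Rightarrow> nat list \<Rightarrow> bool" where
  "monomial_step d q q' \<longleftrightarrow> q' = replicate d 0 \<or> (\<exists>j<d. q' = incr q j)"

text \<open>Strong induction on the degree: lowering one positive exponent by 1 gives a monomial of
  smaller degree, and multiplying by that coordinate again is the last step of the path.\<close>

lemma monomial_path:
  assumes "q \<in> monomials d p"
  shows "\<exists>xs. xs \<noteq> [] \<and> hd xs = replicate d 0 \<and> last xs = q \<and> set xs \<subseteq> monomials d p \<and>
    successively (monomial_step d) xs"
  using assms
proof (induction "sum_list q" arbitrary: q rule: less_induct)
  case less
  then have q: "length q = d" "sum_list q \<le> p" by (auto simp: monomials_def)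
  show ?case
  proof (cases "\<exists>k<d. q ! k > 0")
    case False
    then have "q = replicate d 0" using q by (auto intro: nth_equalityI)
    then show ?thesis by (intro exI[of _ "[q]"]) (use less in auto)
  next
    case True
    then obtain k where k: "k < d" "q ! k > 0" by blast
    define q' where "q' = q[k := q ! k - 1]"
    have q': "q = incr q' k" using k q by (simp add: q'_def incr_def)
    \<comment> \<open>This keeps the truncated subtraction in \<open>sum_list_update\<close>
      exact.\<close>
    have "q ! k \<le> sum_list q" using k q by (intro member_le_sum_list) auto
    then have s: "sum_list q' < sum_list q"
      using k q by (simp add: q'_def sum_list_update)
    moreover have "q' \<in> monomials d p" using q s by (auto simp: monomials_def q'_def)
    ultimately obtain xs where xs: "xs \<noteq> []" "hd xs = replicate d 0" "last xs = q'"
        "set xs \<subseteq> monomials d p" "successively (monomial_step d) xs"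
      using less(1) by blast
    then show ?thesis
      by (intro exI[of _ "xs @ [q]"])
        (use less k q' in \<open>auto simp: successively_append_iff monomial_step_def\<close>)
  qed
qed

text \<open>Every path from \<open>monomial_path\<close> begins at the constant monomial, so a reset
  joins it to the end of any walk already built.\<close>

lemma monomial_covering_walk:
  assumes "finite F" "F \<subseteq> monomials d p"
  shows "\<exists>xs. xs \<noteq> [] \<and> hd xs = replicate d 0 \<and> F \<subseteq> set xs \<and> set xs \<subseteq> monomials d p \<and>
    successively (monomial_step d) xs"
  using assms
proof (induction F)
  case empty
  show ?case
    by (intro exI[of _ "[replicate d 0]"]) (auto simp: replicate_in_monomials)
next
  case (insert q F)
  then obtain xs where xs: "xs \<noteq> []" "hd xs = replicate d 0" "F \<subseteq> set xs"
      "set xs \<subseteq> monomials d p" "successively (monomial_step d) xs"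
    by auto
  obtain ys where ys: "ys \<noteq> []" "hd ys = replicate d 0" "last ys = q"
      "set ys \<subseteq> monomials d p" "successively (monomial_step d) ys"
    using monomial_path[of q d p] insert by auto
  have "q \<in> set ys" using ys by auto
  then show ?case
    by (intro exI[of _ "xs @ ys"])
      (use xs ys in \<open>auto simp: successively_append_iff monomial_step_def\<close>)
qed

text \<open>The covering walk begins at the constant monomial, so the jump from its end back to its
  head is a reset. Reading it modulo its length gives an infinite periodic walk.\<close>

lemma monomial_cyclic_walk:
  obtains a T where "T > 0" "a 0 = replicate d 0" "\<And>k. a (k + T) = a k"
    "\<And>k. monomial_step d (a k) (a (Suc k))" "a ` {..<T} = monomials d p"
proof -
  obtain xs where xs: "xs \<noteq> []" "hd xs = replicate d 0" "set xs = monomials d p"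
      "successively (monomial_step d) xs"
    using monomial_covering_walk[OF finite_monomials order.refl, of d p] by blast
  define T where "T = length xs"
  define a where "a k = xs ! (k mod T)" for k
  have T: "T > 0" using xs by (simp add: T_def)
  have step: "monomial_step d (a k) (a (Suc k))" for k
  proof (cases "Suc (k mod T) < T")
    case True
    then have "Suc k mod T = Suc (k mod T)" by (simp add: mod_Suc)
    then show ?thesis using successively_nth[OF xs(4), of "k mod T"] True
      by (simp add: a_def T_def)
  next
    case False
    then have "Suc k mod T = 0" using T by (simp add: mod_Suc) (meson Suc_lessI mod_less_divisor)
    then show ?thesis using xs by (simp add: a_def monomial_step_def hd_conv_nth)
  qed
  have "a ` {..<T} = set xs"
    by (auto simp: a_def T_def set_conv_nth image_def)
  then show ?thesis
    using T step xs by (intro that[of T a]) (auto simp: a_def hd_conv_nth)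
qed

section \<open>Descent steps seen through the values of the polynomial\<close>

text \<open>A polynomial value is affine in each single coefficient (\<open>upd\<close>), so the
  loss is quadratic along a coordinate; the 2 from the square cancels the 2 in the
  normalisation.\<close>

lemma partial_deriv_icl_loss:
  assumes "q \<in> monomials d p"
  shows "partial_deriv (icl_loss d p n x y) q w
    = 1 / real n * (\<Sum>i<n. (poly_fun d p w (x i) + y i) * monomial_val q (x i))"
proof -
  have upd: "poly_fun d p (w(q := t)) z = poly_fun d p w z + (t - w q) * monomial_val q z" for t z
  proof -
    have "poly_fun d p (w(q := t)) z - poly_fun d p w z
        = (\<Sum>r\<in>monomials d p. if r = q then (t - w q) * monomial_val q z else 0)"
      unfolding poly_fun_def sum_subtractf[symmetric]
      by (rule sum.cong) (auto simp: algebra_simps)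
    then show ?thesis
      using assms finite_monomials[of d p] by simp
  qed
  have "((\<lambda>t. icl_loss d p n x y (w(q := t))) has_field_derivative
      (1 / (2 * real n) * (\<Sum>i<n. 2 * ((poly_fun d p w (x i) + y i) * monomial_val q (x i)))))
      (at (w q))"
    unfolding icl_loss_def upd
    by (rule DERIV_cmult DERIV_sum)+
      (auto intro!: derivative_eq_intros)
  then show ?thesis
    unfolding partial_deriv_def
    by (simp add: DERIV_imp_deriv sum_distrib_left[symmetric])
qed

text \<open>This is the form in which attention can carry out the step: the coefficients are never
  stored, only their effect on values, a residual-weighted sum of a feature kernel with
  \<open>- \<eta> (Suc l)\<close> in the place of the entries of \<open>Q\<close>. All partial
  derivatives are taken at the old iterate, so the block contributes additively.\<close>

lemma poly_fun_bcd_Suc: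
  fixes x :: "nat \<Rightarrow> real vec" and y \<eta> :: "nat \<Rightarrow> real" and d p n l :: nat
    and b :: "nat \<Rightarrow> nat list set"
  assumes "b (Suc l) \<subseteq> monomials d p"
  defines "w \<equiv> bcd (icl_loss d p n x y) \<eta> b l"
  shows "poly_fun d p (bcd (icl_loss d p n x y) \<eta> b (Suc l)) z
    = poly_fun d p w z + 1 / real n * (\<Sum>i<n. (poly_fun d p w (x i) + y i) *
        (\<Sum>q\<in>b (Suc l). monomial_val q (x i) * - \<eta> (Suc l) * monomial_val q z))"
proof -
  let ?D = "\<lambda>q. partial_deriv (icl_loss d p n x y) q w"
  have "poly_fun d p (bcd (icl_loss d p n x y) \<eta> b (Suc l)) z - poly_fun d p w z
      = (\<Sum>q\<in>monomials d p. if q \<in> b (Suc l) then - \<eta> (Suc l) * ?D q * monomial_val q z else 0)"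
    unfolding poly_fun_def sum_subtractf[symmetric] w_def
    by (rule sum.cong) (auto simp: algebra_simps)
  also have "\<dots> = (\<Sum>q\<in>b (Suc l). - \<eta> (Suc l) * ?D q * monomial_val q z)"
    using assms(1) finite_monomials[of d p]
    by (simp add: sum.inter_restrict[symmetric] Int_absorb1)
  also have "\<dots> = (\<Sum>q\<in>b (Suc l). \<Sum>i<n. 1 / real n * ((poly_fun d p w (x i) + y i) *
        (monomial_val q (x i) * - \<eta> (Suc l) * monomial_val q z)))"
    using assms(1)
    by (intro sum.cong refl, subst partial_deriv_icl_loss)
      (auto simp: sum_distrib_left sum_distrib_right mult_ac)
  also have "\<dots> = 1 / real n * (\<Sum>i<n. (poly_fun d p w (x i) + y i) *
        (\<Sum>q\<in>b (Suc l). monomial_val q (x i) * - \<eta> (Suc l) * monomial_val q z))"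
    by (subst sum.swap) (simp add: sum_distrib_left)
  finally show ?thesis by simp
qed

section \<open>Entries of the layer outputs\<close>

lemma index_mult_mat_sum:
  assumes "A \<in> carrier_mat m k" "B \<in> carrier_mat k l" "i < m" "j < l"
  shows "(A * B) $$ (i, j) = (\<Sum>c<k. A $$ (i, c) * B $$ (c, j))"
  using assms by (simp add: scalar_prod_def atLeast0LessThan)

text \<open>The zero block appended to both weight matrices annihilates the update in the last row,
  so labels pass through a bilinear layer unchanged.\<close>

lemma bilin_index:
  assumes "W0 \<in> carrier_mat e e" "W1 \<in> carrier_mat e e" "Z \<in> carrier_mat (e + 1) m"
    and "r < e + 1" "j < m"
  shows "bilin W0 W1 Z $$ (r, j) = Z $$ (r, j) +
    (if r < e then (\<Sum>c<e. W0 $$ (r, c) * Z $$ (c, j)) * (\<Sum>c<e. W1 $$ (r, c) * Z $$ (c, j)) else 0)"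
proof -
  have D: "diag_block_mat [W, 0\<^sub>m 1 1] \<in> carrier_mat (e + 1) (e + 1)"
    if "W \<in> carrier_mat e e" for W :: "real mat"
    using that by (auto simp: Let_def)
  have "(diag_block_mat [W, 0\<^sub>m 1 1] * Z) $$ (r, j)
      = (if r < e then \<Sum>c<e. W $$ (r, c) * Z $$ (c, j) else 0)"
    if W: "W \<in> carrier_mat e e" for W
  proof -
    have "(diag_block_mat [W, 0\<^sub>m 1 1] * Z) $$ (r, j)
        = (\<Sum>c<e + 1. diag_block_mat [W, 0\<^sub>m 1 1] $$ (r, c) * Z $$ (c, j))"
      by (rule index_mult_mat_sum[OF D[OF W] assms(3-5)])
    also have "\<dots> = (if r < e then \<Sum>c<e. W $$ (r, c) * Z $$ (c, j) else 0)"
      using W assms by (auto simp: Let_def)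
    finally show ?thesis .
  qed
  then show ?thesis
    using assms by (simp add: bilin_def hadamard_def dim_diag_block_mat
        del: diag_block_mat.simps index_mult_mat(1))
qed

text \<open>The mask removes the query column from the sum, which therefore runs over the context
  only. Here \<open>e\<close> counts all rows, label row included, unlike in
  \<open>bilin_index\<close>.\<close>

lemma attn_index:
  assumes "P \<in> carrier_mat e e" "Q \<in> carrier_mat e e" "Z \<in> carrier_mat e (n + 1)"
    and "r < e" "j < n + 1"
  shows "attn n P Q Z $$ (r, j) = Z $$ (r, j) + 1 / real n *
    (\<Sum>i<n. (\<Sum>c<e. P $$ (r, c) * Z $$ (c, i)) *
      (\<Sum>c<e. (\<Sum>c'<e. Z $$ (c', i) * Q $$ (c', c)) * Z $$ (c, j)))"
proof -
  define M :: "real mat" where "M = diag_block_mat [1\<^sub>m n, 0\<^sub>m 1 1]"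
  let ?A = "P * Z" and ?B = "transpose_mat Z * Q * Z"
  have M: "M \<in> carrier_mat (n + 1) (n + 1)" by (auto simp: M_def Let_def)
  have Mi: "M $$ (i, k) = (if i = k \<and> i < n then 1 else 0)" if "i < n + 1" "k < n + 1" for i k
    using that by (auto simp: M_def Let_def)
  have A: "?A \<in> carrier_mat e (n + 1)" and B: "?B \<in> carrier_mat (n + 1) (n + 1)"
    using assms by auto
  have AM: "(?A * M) $$ (r, k) = (if k < n then ?A $$ (r, k) else 0)" if k: "k < n + 1" for k
  proof -
    have "(?A * M) $$ (r, k) = (\<Sum>i<n + 1. ?A $$ (r, i) * M $$ (i, k))"
      by (rule index_mult_mat_sum[OF A M assms(4) k])
    also have "\<dots> = (\<Sum>i<n + 1. if i = k then (if k < n then ?A $$ (r, k) else 0) else 0)"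
      using k by (intro sum.cong) (auto simp: Mi)
    finally show ?thesis using k by simp
  qed
  have Bi: "?B $$ (i, j) = (\<Sum>c<e. (\<Sum>c'<e. Z $$ (c', i) * Q $$ (c', c)) * Z $$ (c, j))"
    if i: "i < n + 1" for i
  proof -
    have Zt: "transpose_mat Z \<in> carrier_mat (n + 1) e" using assms by simp
    have "?B $$ (i, j) = (\<Sum>c<e. (transpose_mat Z * Q) $$ (i, c) * Z $$ (c, j))"
      by (rule index_mult_mat_sum[OF _ assms(3) i assms(5)]) (use Zt assms in simp)
    also have "\<dots> = (\<Sum>c<e. (\<Sum>c'<e. Z $$ (c', i) * Q $$ (c', c)) * Z $$ (c, j))"
      using i assms by (intro sum.cong) (simp_all add: index_mult_mat_sum[OF Zt assms(2)] del: index_mult_mat(1))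
    finally show ?thesis .
  qed
  have "(?A * M * ?B) $$ (r, j) = (\<Sum>i<n + 1. (?A * M) $$ (r, i) * ?B $$ (i, j))"
    by (rule index_mult_mat_sum[OF _ B assms(4,5)]) (use A M in simp)
  also have "\<dots> = (\<Sum>i<n. ?A $$ (r, i) * ?B $$ (i, j))"
    by (simp add: AM del: index_mult_mat)
  also have "\<dots> = (\<Sum>i<n. (\<Sum>c<e. P $$ (r, c) * Z $$ (c, i)) *
      (\<Sum>c<e. (\<Sum>c'<e. Z $$ (c', i) * Q $$ (c', c)) * Z $$ (c, j)))"
    using assms by (intro sum.cong refl, subst Bi)
      (auto simp: index_mult_mat_sum[OF assms(1,3)] simp del: index_mult_mat(1))
  finally show ?thesis
    unfolding attn_def M_def[symmetric]
    using A M B assms by (simp del: index_mult_mat(1))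
qed


section \<open>Embedded states and the action of the layers on them\<close>

text \<open>Rows \<open>0, ..., d\<close> keep the constant feature and the coordinates; row \<open>d + 1\<close> is a
  register \<open>s\<close> for one further monomial.\<close>

definition emb_state ::
  "nat \<Rightarrow> nat \<Rightarrow> (nat \<Rightarrow> real vec) \<Rightarrow> (nat \<Rightarrow> real) \<Rightarrow> (nat \<Rightarrow> real) \<Rightarrow> real mat" where
  "emb_state d n x s lab = mat (2 * d + 2) (n + 1) (\<lambda>(r, j).
     if r = 0 then 1
     else if r \<le> d then x j $ (r - 1)
     else if r = Suc d then s j
     else if r < 2 * d + 1 then 0
     else lab j)"

text \<open>The monomial carried by row \<open>r\<close> when the register holds \<open>q\<close>;
  it is meaningful for rows up to the register, \<open>r \<le> Suc d\<close>.\<close>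

definition row_feature :: "nat \<Rightarrow> nat list \<Rightarrow> nat \<Rightarrow> nat list" where
  "row_feature d q r =
     (if r = 0 then replicate d 0 else if r \<le> d then incr (replicate d 0) (r - 1) else q)"

lemma length_row_feature: "length q = d \<Longrightarrow> length (row_feature d q r) = d"
  by (simp add: row_feature_def)

lemma emb_state_carrier [simp]: "emb_state d n x s lab \<in> carrier_mat (2 * d + 1 + 1) (n + 1)"
  by (simp add: emb_state_def)

text \<open>With \<open>d \<ge> 1\<close> the register is one of the zero rows of the prompt; for
  \<open>d = 0\<close> it would coincide with the label row.\<close>

lemma prompt_eq_emb_state:
  assumes "d \<ge> 1"
  shows "prompt d (2 * d + 1) n x y
    = emb_state d n x (\<lambda>_. 0) (\<lambda>j. if j < n then y j else 0)"
  using assms by (intro eq_matI) (auto simp: prompt_def emb_state_def)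

lemma emb_state_row_feature:
  assumes "d \<ge> 1" "r \<le> Suc d" "j \<le> n"
  shows "emb_state d n x (\<lambda>j. monomial_val q (x j)) lab $$ (r, j)
    = monomial_val (row_feature d q r) (x j)"
proof -
  have "emb_state d n x (\<lambda>j. monomial_val q (x j)) lab $$ (r, j) =
      (if r = 0 then 1 else if r \<le> d then x j $ (r - 1) else monomial_val q (x j))"
    using assms unfolding emb_state_def by (subst index_mat) auto
  then show ?thesis by (auto simp: row_feature_def monomial_val_incr)
qed

text \<open>Weights supported in the register's row leave every other row alone, and there the layer
  adds the product of two freely chosen linear forms of the column.\<close>

lemma bilin_emb_state:
  fixes u v :: "nat \<Rightarrow> real"
  assumes "d \<ge> 1"
  defines "W \<equiv> \<lambda>v. mat (2 * d + 1) (2 * d + 1) (\<lambda>(r, c). if r = Suc d then v c else (0 :: real))"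
  shows "bilin (W u) (W v) (emb_state d n x s lab) = emb_state d n x
    (\<lambda>j. s j + (\<Sum>c<2 * d + 1. u c * emb_state d n x s lab $$ (c, j)) *
      (\<Sum>c<2 * d + 1. v c * emb_state d n x s lab $$ (c, j))) lab" (is "?B = ?S")
proof (rule eq_matI)
  have W: "W v \<in> carrier_mat (2 * d + 1) (2 * d + 1)" for v by (simp add: W_def)
  have dimB: "dim_row ?B = 2 * d + 2" "dim_col ?B = n + 1"
    using emb_state_carrier[of d n x s lab]
    by (simp_all add: bilin_def hadamard_def dim_diag_block_mat W_def del: diag_block_mat.simps)
  then show "dim_row ?B = dim_row ?S" "dim_col ?B = dim_col ?S"
    by (simp_all add: emb_state_def)
  fix r j assume "r < dim_row ?S" "j < dim_col ?S"
  then have r: "r < 2 * d + 1 + 1" and j: "j < n + 1" by (simp_all add: emb_state_def)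
  let ?Z = "emb_state d n x s lab"
  have sums: "(\<Sum>c<2 * d + 1. W v $$ (r, c) * ?Z $$ (c, j))
      = (if r = Suc d then \<Sum>c<2 * d + 1. v c * ?Z $$ (c, j) else 0)" if "r < 2 * d + 1" for v
    using that by (auto simp: W_def intro!: sum.neutral sum.cong)
  show "?B $$ (r, j) = ?S $$ (r, j)"
  proof (cases "r = Suc d")
    case True
    then have "?S $$ (r, j) = s j + (\<Sum>c<2 * d + 1. u c * ?Z $$ (c, j)) *
        (\<Sum>c<2 * d + 1. v c * ?Z $$ (c, j))"
      \<comment> \<open>The pattern for the register content unfolds only the outer state and leaves
        \<open>?Z\<close> in the sums folded.\<close>
      using r j unfolding emb_state_def[of d n x "\<lambda>j. s j + _ j"] by (subst index_mat) auto
    moreover have "?Z $$ (r, j) = s j"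
      using True r j unfolding emb_state_def by (subst index_mat) auto
    moreover have "r < 2 * d + 1" using True assms(1) by simp
    ultimately show ?thesis
      using True sums unfolding bilin_index[OF W W emb_state_carrier r j] by simp
  next
    case False
    then have "?S $$ (r, j) = ?Z $$ (r, j)"
      using r j by (simp add: emb_state_def)
    then show ?thesis
      using False sums unfolding bilin_index[OF W W emb_state_carrier r j] by simp
  qed
qed

lemma sum_single:
  fixes f :: "nat \<Rightarrow> real"
  assumes "k < m"
  shows "(\<Sum>c<m. (if c = k then 1 else 0) * f c) = f k"
  using assms by (simp add: if_distrib[of "\<lambda>t. t * _"] cong: if_cong)

lemma sum_diff_single:
  fixes f :: "nat \<Rightarrow> real"
  assumes "k < m" "k' < m"
  shows "(\<Sum>c<m. ((if c = k then 1 else 0) - (if c = k' then 1 else 0)) * f c) = f k - f k'"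
  by (simp add: left_diff_distrib sum_subtractf sum_single assms)

text \<open>The residual connection \<open>s + (u z) (v z)\<close> can only add to the register; \<open>s + (1 - s) 1\<close>
  resets it and \<open>s + s (x[k] - 1)\<close> multiplies it by \<open>x[k]\<close>.\<close>

lemma bilin_monomial_step:
  assumes "d \<ge> 1" "length q = d" "monomial_step d q q'"
  shows "\<exists>W0 W1. W0 \<in> carrier_mat (2 * d + 1) (2 * d + 1) \<and>
    W1 \<in> carrier_mat (2 * d + 1) (2 * d + 1) \<and>
    (\<forall>n x s lab. q' = replicate d 0 \<or> s = (\<lambda>j. monomial_val q (x j)) \<longrightarrow>
      bilin W0 W1 (emb_state d n x s lab) = emb_state d n x (\<lambda>j. monomial_val q' (x j)) lab)"
proof -
  define W where "W v = mat (2 * d + 1) (2 * d + 1)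
    (\<lambda>(r, c). if r = Suc d then v c else (0 :: real))" for v
  \<comment> \<open>\<open>\<delta> k\<close> is the weight row that reads off row \<open>k\<close>.
    Row 0 supplies the constant 1, row \<open>Suc d\<close> the register and row
    \<open>Suc k\<close> coordinate \<open>k\<close>, so all required factors are such rows or
    differences of two.\<close>
  define \<delta> :: "nat \<Rightarrow> nat \<Rightarrow> real" where "\<delta> k c = (if c = k then 1 else 0)" for k c
  have W: "W v \<in> carrier_mat (2 * d + 1) (2 * d + 1)" for v by (simp add: W_def)
  have cong: "emb_state d n x s lab = emb_state d n x s' lab" if "\<And>j. j \<le> n \<Longrightarrow> s j = s' j"
    for n and x :: "nat \<Rightarrow> real vec" and s s' lab
    using that by (intro eq_matI) (auto simp: emb_state_def)
  have Z: "emb_state d n x s lab $$ (0, j) = 1" "emb_state d n x s lab $$ (Suc d, j) = s j"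
      "k < d \<Longrightarrow> emb_state d n x s lab $$ (Suc k, j) = x j $ k"
    if "j \<le> n" for n and x :: "nat \<Rightarrow> real vec" and s lab j k
    using that assms(1) unfolding emb_state_def by (subst index_mat; auto)+
  note bilin = bilin_emb_state[OF assms(1), folded W_def]
  \<comment> \<open>Excluding the reset in the second case guarantees that the register holds
    \<open>q\<close> there; a reset works for arbitrary content.\<close>
  from assms(3) consider "q' = replicate d 0" | k where "k < d" "q' = incr q k"
      "q' \<noteq> replicate d 0"
    unfolding monomial_step_def by blast
  then show ?thesis
  proof cases
    case 1
    show ?thesis
    proof (intro exI conjI allI impI)
      fix n s lab and x :: "nat \<Rightarrow> real vec"
      show "bilin (W (\<lambda>c. \<delta> 0 c - \<delta> (Suc d) c)) (W (\<delta> 0)) (emb_state d n x s lab)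
          = emb_state d n x (\<lambda>j. monomial_val q' (x j)) lab"
        unfolding bilin \<delta>_def using assms(1) 1
        by (intro cong) (simp add: sum_single sum_diff_single Z del: sum.lessThan_Suc)
    qed (rule W)+
  next
    case 2
    show ?thesis
    proof (intro exI conjI allI impI)
      fix n s lab and x :: "nat \<Rightarrow> real vec"
      assume "q' = replicate d 0 \<or> s = (\<lambda>j. monomial_val q (x j))"
      then have s: "s = (\<lambda>j. monomial_val q (x j))" using 2 by simp
      show "bilin (W (\<delta> (Suc d))) (W (\<lambda>c. \<delta> (Suc k) c - \<delta> 0 c)) (emb_state d n x s lab)
          = emb_state d n x (\<lambda>j. monomial_val q' (x j)) lab"
        unfolding bilin \<delta>_def using assms(1,2) 2
        by (intro cong) (simp add: sum_single sum_diff_single Z s monomial_val_incr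
            right_diff_distrib del: sum.lessThan_Suc)
    qed (rule W)+
  qed
qed

text \<open>\<open>P\<close> passes on the label row alone, so no other row changes. A diagonal
  \<open>Q\<close> with entry \<open>h\<close> at selected rows turns the attention scores into the
  kernel of the features in these rows.\<close>

lemma attn_features:
  assumes "d \<ge> 1" "F \<subseteq> row_feature d q ` {..Suc d}"
  shows "\<exists>P Q. P \<in> carrier_mat (2 * d + 2) (2 * d + 2) \<and> Q \<in> carrier_mat (2 * d + 2) (2 * d + 2) \<and>
    (\<forall>n x lab. attn n P Q (emb_state d n x (\<lambda>j. monomial_val q (x j)) lab)
      = emb_state d n x (\<lambda>j. monomial_val q (x j)) (\<lambda>j. lab j + 1 / real n *
          (\<Sum>i<n. lab i * (\<Sum>r\<in>F. monomial_val r (x i) * h * monomial_val r (x j)))))"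
proof -
  \<comment> \<open>Distinct rows may carry the same feature; \<open>U\<close> picks one row for each.\<close>
  obtain U where U: "U \<subseteq> {..Suc d}" "inj_on (row_feature d q) U" "F = row_feature d q ` U"
    using assms(2) unfolding subset_image_inj by blast
  let ?e = "2 * d + 2"
  define P :: "real mat" where
    "P = mat ?e ?e (\<lambda>(r, c). if r = 2 * d + 1 \<and> c = 2 * d + 1 then 1 else 0)"
  define Q where "Q = mat ?e ?e (\<lambda>(r, c). if r = c \<and> r \<in> U then h else 0)"
  have P: "P \<in> carrier_mat ?e ?e" and Q: "Q \<in> carrier_mat ?e ?e"
    by (simp_all add: P_def Q_def)
  have "attn n P Q (emb_state d n x (\<lambda>j. monomial_val q (x j)) lab)
      = emb_state d n x (\<lambda>j. monomial_val q (x j)) (\<lambda>j. lab j + 1 / real n *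
          (\<Sum>i<n. lab i * (\<Sum>r\<in>F. monomial_val r (x i) * h * monomial_val r (x j))))"
    (is "?A = ?S") for n x lab
  proof (rule eq_matI)
    let ?Z = "emb_state d n x (\<lambda>j. monomial_val q (x j)) lab"
    have Z: "?Z \<in> carrier_mat ?e (n + 1)" using emb_state_carrier by simp
    have M: "diag_block_mat [1\<^sub>m n, 0\<^sub>m 1 1] \<in> carrier_mat (n + 1) (n + 1)"
      by (auto simp: Let_def)
    show "dim_row ?A = dim_row ?S" "dim_col ?A = dim_col ?S"
      using P Q Z M by (simp_all add: attn_def emb_state_def del: diag_block_mat.simps)
    fix r j assume "r < dim_row ?S" "j < dim_col ?S"
    then have r: "r < ?e" and j: "j < n + 1" by (simp_all add: emb_state_def)
    have PZ: "(\<Sum>c<?e. P $$ (r, c) * ?Z $$ (c, i)) = (if r = 2 * d + 1 then lab i else 0)"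
      if "i < n" for i
    proof -
      have "(\<Sum>c<?e. P $$ (r, c) * ?Z $$ (c, i))
          = (\<Sum>c<?e. if c = 2 * d + 1 then (if r = 2 * d + 1 then ?Z $$ (c, i) else 0) else 0)"
        using r by (intro sum.cong) (auto simp: P_def)
      also have "\<dots> = (if r = 2 * d + 1 then ?Z $$ (2 * d + 1, i) else 0)"
        by (subst sum.delta) auto
      also have "?Z $$ (2 * d + 1, i) = lab i"
        using that assms(1) unfolding emb_state_def by (subst index_mat) auto
      finally show ?thesis .
    qed
    have ZQZ: "(\<Sum>c<?e. (\<Sum>c'<?e. ?Z $$ (c', i) * Q $$ (c', c)) * ?Z $$ (c, j))
        = (\<Sum>r\<in>F. monomial_val r (x i) * h * monomial_val r (x j))" if i: "i < n" for i
    proof -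
      have *: "(\<Sum>c'<?e. ?Z $$ (c', i) * Q $$ (c', c)) = (if c \<in> U then ?Z $$ (c, i) * h else 0)"
        if "c < ?e" for c
      proof -
        have "(\<Sum>c'<?e. ?Z $$ (c', i) * Q $$ (c', c))
            = (\<Sum>c'<?e. if c' = c then (if c \<in> U then ?Z $$ (c, i) * h else 0) else 0)"
          using that by (intro sum.cong) (auto simp: Q_def)
        then show ?thesis using that by simp
      qed
      have "(\<Sum>c<?e. (\<Sum>c'<?e. ?Z $$ (c', i) * Q $$ (c', c)) * ?Z $$ (c, j))
          = (\<Sum>c<?e. if c \<in> U then ?Z $$ (c, i) * h * ?Z $$ (c, j) else 0)"
        by (intro sum.cong refl, subst *) auto
      also have "\<dots> = (\<Sum>c\<in>U. ?Z $$ (c, i) * h * ?Z $$ (c, j))"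
      proof -
        have "{..<?e} \<inter> U = U" using U(1) assms(1) by force
        then show ?thesis by (simp add: sum.inter_restrict[symmetric] del: sum.lessThan_Suc)
      qed
      also have "\<dots> = (\<Sum>c\<in>U. monomial_val (row_feature d q c) (x i) * h *
          monomial_val (row_feature d q c) (x j))"
        using U(1) i j assms(1) by (intro sum.cong refl) (subst (1 2) emb_state_row_feature; auto)
      also have "\<dots> = (\<Sum>r\<in>F. monomial_val r (x i) * h * monomial_val r (x j))"
        by (simp add: U sum.reindex)
      finally show ?thesis .
    qed
    have "?A $$ (r, j) = ?Z $$ (r, j) + 1 / real n * (\<Sum>i<n. (if r = 2 * d + 1 then lab i else 0) *
        (\<Sum>r\<in>F. monomial_val r (x i) * h * monomial_val r (x j)))"
      unfolding attn_index[OF P Q Z r j]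
      by (intro arg_cong2[where f = "(+)"] arg_cong2[where f = "(*)"] refl, rule sum.cong[OF refl])
        (simp only: PZ ZQZ lessThan_iff)
    also have "\<dots> = ?S $$ (r, j)"
      using r j assms(1) unfolding emb_state_def by (subst (1 2) index_mat) auto
    finally show "?A $$ (r, j) = ?S $$ (r, j)" .
  qed
  with P Q show ?thesis by blast
qed

section \<open>One block as one descent step\<close>

text \<open>Inputs, labels and context length are quantified inside because the weights must be
  fixed before the prompt is seen. In a reset \<open>s\<close> is arbitrary, which admits the
  initial register content 0.\<close>

definition implements_step ::
  "nat \<Rightarrow> nat list \<Rightarrow> nat list \<Rightarrow> nat list set \<Rightarrow> real \<Rightarrow> tf_block \<Rightarrow> bool" where
  "implements_step d q q' F h B \<longleftrightarrow>
    blk_W0 B \<in> carrier_mat (2 * d + 1) (2 * d + 1) \<and>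
    blk_W1 B \<in> carrier_mat (2 * d + 1) (2 * d + 1) \<and>
    blk_P B \<in> carrier_mat (2 * d + 2) (2 * d + 2) \<and>
    blk_Q B \<in> carrier_mat (2 * d + 2) (2 * d + 2) \<and>
    (\<forall>n x s lab. q' = replicate d 0 \<or> s = (\<lambda>j. monomial_val q (x j)) \<longrightarrow>
      bilin (blk_W0 B) (blk_W1 B) (emb_state d n x s lab)
        = emb_state d n x (\<lambda>j. monomial_val q' (x j)) lab) \<and>
    (\<forall>n x lab. attn n (blk_P B) (blk_Q B) (emb_state d n x (\<lambda>j. monomial_val q' (x j)) lab)
      = emb_state d n x (\<lambda>j. monomial_val q' (x j)) (\<lambda>j. lab j + 1 / real n *
          (\<Sum>i<n. lab i * (\<Sum>r\<in>F. monomial_val r (x i) * h * monomial_val r (x j)))))"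

lemma implements_step_exists:
  assumes "d \<ge> 1" "length q = d" "monomial_step d q q'" "F \<subseteq> row_feature d q' ` {..Suc d}"
  shows "\<exists>B. implements_step d q q' F h B"
proof -
  obtain W0 W1 where W: "W0 \<in> carrier_mat (2 * d + 1) (2 * d + 1)"
      "W1 \<in> carrier_mat (2 * d + 1) (2 * d + 1)"
      "\<forall>n x s lab. q' = replicate d 0 \<or> s = (\<lambda>j. monomial_val q (x j)) \<longrightarrow>
        bilin W0 W1 (emb_state d n x s lab) = emb_state d n x (\<lambda>j. monomial_val q' (x j)) lab"
    using bilin_monomial_step[OF assms(1-3)] by blast
  obtain P Q where PQ: "P \<in> carrier_mat (2 * d + 2) (2 * d + 2)"
      "Q \<in> carrier_mat (2 * d + 2) (2 * d + 2)"
      "\<forall>n x lab. attn n P Q (emb_state d n x (\<lambda>j. monomial_val q' (x j)) lab)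
        = emb_state d n x (\<lambda>j. monomial_val q' (x j)) (\<lambda>j. lab j + 1 / real n *
            (\<Sum>i<n. lab i * (\<Sum>r\<in>F. monomial_val r (x i) * h * monomial_val r (x j))))"
    using attn_features[OF assms(1,4), of h] by blast
  show ?thesis
    by (rule exI[of _ "\<lparr>blk_W0 = W0, blk_W1 = W1, blk_P = P, blk_Q = Q\<rparr>"])
      (use W PQ in \<open>simp add: implements_step_def\<close>)
qed

section \<open>Features readable from a state\<close>

text \<open>Links the semantic notion in \<open>bilin_features\<close> to explicit rows. A row up to
  the register determines its monomial by its values, and the rows between register and labels are
  zero, which no monomial is.\<close>

lemma row_feature_iff:
  assumes "d \<ge> 1" "length q = d" "length q' = d"
  shows "q' \<in> row_feature d q ` {..Suc d} \<longleftrightarrow>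
    (\<exists>r<2 * d + 1. \<forall>x. (\<forall>j\<le>n. x j \<in> carrier_vec d) \<longrightarrow>
      (\<forall>j\<le>n. emb_state d n x (\<lambda>j. monomial_val q (x j)) lab $$ (r, j) = monomial_val q' (x j)))"
    (is "_ \<longleftrightarrow> (\<exists>r<_. ?carries r)")
proof
  assume "q' \<in> row_feature d q ` {..Suc d}"
  then obtain r where r: "r \<le> Suc d" "q' = row_feature d q r" by auto
  then have "?carries r" using assms(1) by (simp add: emb_state_row_feature)
  then show "\<exists>r<2 * d + 1. ?carries r" using r assms(1) by (intro exI[of _ r]) auto
next
  assume "\<exists>r<2 * d + 1. ?carries r"
  then obtain r where r: "r < 2 * d + 1" "?carries r" by blast
  show "q' \<in> row_feature d q ` {..Suc d}"
  proof (cases "r \<le> Suc d")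
    case True
    have "monomial_val (row_feature d q r) z = monomial_val q' z" if "z \<in> carrier_vec d" for z
      \<comment> \<open>A constant family of inputs lets column 0 test an arbitrary point.\<close>
      using r(2)[rule_format, of "\<lambda>_. z" 0] that True assms(1)
      by (simp add: emb_state_row_feature)
    then have "row_feature d q r = q'"
      by (intro monomial_val_inject[of _ d]) (use assms length_row_feature in auto)
    then show ?thesis using True by auto
  next
    case False
    \<comment> \<open>At the all-ones point every monomial equals 1, whereas this row holds
      0.\<close>
    let ?x = "\<lambda>j :: nat. vec d (\<lambda>_. 1 :: real)"
    have "monomial_val q' (?x 0) = 1" using assms by (simp add: monomial_val_def)
    moreover have "emb_state d n ?x (\<lambda>j. monomial_val q (?x j)) lab $$ (r, 0) = 0"
      using r(1) False unfolding emb_state_def by (subst index_mat) auto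
    ultimately show ?thesis using r(2)[rule_format, of ?x 0] by simp
  qed
qed

section \<open>Assembly of the Transformer along the cyclic walk\<close>

theorem corollary8:
  fixes M :: "'a measure"
    and X :: "nat \<Rightarrow> 'a \<Rightarrow> real vec"
    and C :: "nat list \<Rightarrow> 'a \<Rightarrow> real"
    and d p n :: nat
    and \<eta> :: "nat \<Rightarrow> real"
  assumes "d \<ge> 1" and "n \<ge> 1"
    and "poly_icl_task M d p n X C"
  shows "\<exists>b. cycles_through b (monomials d p) \<and>
    (\<forall>L. \<exists>TF. bilinear_transformer (2 * d + 1) L TF \<and>
      (\<forall>l\<in>{1..L}. b l = bilin_features d p (2 * d + 1) n TF l) \<and>
      (\<forall>\<omega>\<in>space M. \<forall>l\<le>L.
        tf_state n TF (poly_prompt d p (2 * d + 1) n (\<lambda>i. X i \<omega>) (\<lambda>q. C q \<omega>)) (2 * l)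
            $$ (2 * d + 1, n)
          = poly_fun d p
              (bcd (icl_loss d p n (\<lambda>i. X i \<omega>)
                     (\<lambda>i. poly_fun d p (\<lambda>q. C q \<omega>) (X i \<omega>))) \<eta> b l)
              (X n \<omega>)))"
proof -
  obtain a T where T: "T > 0" and a0: "a 0 = replicate d 0" and per: "\<And>k. a (k + T) = a k"
      and step: "\<And>k. monomial_step d (a k) (a (Suc k))" and cover: "a ` {..<T} = monomials d p"
    by (rule monomial_cyclic_walk[of d p]) (rule that)
  have a: "length (a k) = d" for k
  proof (induction k)
    case (Suc k)
    then show ?case using step[of k] by (auto simp: monomial_step_def)
  qed (simp add: a0)
  \<comment> \<open>Layers count from 1 and the walk from 0, so the register after bilinear layer
    \<open>l\<close> holds \<open>a (l - 1)\<close>. The intersection matters for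
    \<open>p = 0\<close>, where the coordinates exceed the degree bound. The choice is independent
    of \<open>L\<close>.\<close>
  define b where "b l = row_feature d (a (l - 1)) ` {..Suc d} \<inter> monomials d p" for l
  have b_mon: "b l \<subseteq> monomials d p" for l by (simp add: b_def)
  have "cycles_through b (monomials d p)"
    unfolding cycles_through_def
  proof (intro exI conjI allI impI)
    fix l :: nat assume "l \<ge> 1"
    then show "b (l + T) = b l" using per[of "l - 1"] by (simp add: b_def)
  next
    have "q \<in> (\<Union>l\<in>{1..T}. b l)" if q: "q \<in> monomials d p" for q
    proof -
      obtain k where k: "k < T" "q = a k" using q cover by auto
      \<comment> \<open>The register alone already visits every monomial within one period.\<close>
      have "q = row_feature d (a k) (Suc d)" by (simp add: row_feature_def k)
      then have "q \<in> b (Suc k)" using q by (auto simp: b_def)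
      then show ?thesis using k by (intro UN_I[of "Suc k"]) auto
    qed
    then show "(\<Union>l\<in>{1..T}. b l) = monomials d p" using b_mon by blast
  qed (rule T)
  moreover have "\<exists>TF. bilinear_transformer (2 * d + 1) L TF \<and>
      (\<forall>l\<in>{1..L}. b l = bilin_features d p (2 * d + 1) n TF l) \<and>
      (\<forall>\<omega>\<in>space M. \<forall>l\<le>L.
        tf_state n TF (poly_prompt d p (2 * d + 1) n (\<lambda>i. X i \<omega>) (\<lambda>q. C q \<omega>)) (2 * l)
            $$ (2 * d + 1, n)
          = poly_fun d p
              (bcd (icl_loss d p n (\<lambda>i. X i \<omega>)
                     (\<lambda>i. poly_fun d p (\<lambda>q. C q \<omega>) (X i \<omega>))) \<eta> b l)
              (X n \<omega>))" for L
  proof -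
    \<comment> \<open>For \<open>k = 0\<close> truncated subtraction gives
      \<open>a (0 - 1) = a 0\<close>, and the step is a reset.\<close>
    have step': "monomial_step d (a (k - 1)) (a k)" for k
      using step a0 by (cases k) (auto simp: monomial_step_def)
    have "\<exists>B. implements_step d (a (k - 1)) (a k) (b (Suc k)) (- \<eta> (Suc k)) B" for k
      by (rule implements_step_exists[OF assms(1) a step']) (simp add: b_def)
    then obtain blk where
      blk: "\<And>k. implements_step d (a (k - 1)) (a k) (b (Suc k)) (- \<eta> (Suc k)) (blk k)"
      by metis
    have bilin: "bilin (blk_W0 (blk k)) (blk_W1 (blk k)) (emb_state d n x s lab)
          = emb_state d n x (\<lambda>j. monomial_val (a k) (x j)) lab"
      if "a k = replicate d 0 \<or> s = (\<lambda>j. monomial_val (a (k - 1)) (x j))" for k x s lab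
      using blk[of k] that unfolding implements_step_def by blast
    have attn: "attn n (blk_P (blk k)) (blk_Q (blk k))
          (emb_state d n x (\<lambda>j. monomial_val (a k) (x j)) lab)
        = emb_state d n x (\<lambda>j. monomial_val (a k) (x j)) (\<lambda>j. lab j + 1 / real n *
            (\<Sum>i<n. lab i * (\<Sum>r\<in>b (Suc k). monomial_val r (x i) * - \<eta> (Suc k) *
              monomial_val r (x j))))" for k x lab
      using blk[of k] unfolding implements_step_def by blast
    define TF where "TF = map blk [0..<L]"
    have TF: "TF ! k = blk k" if "k < L" for k using that by (simp add: TF_def)
    define y where "y c x = (\<lambda>i. poly_fun d p c (x i))" for c and x :: "nat \<Rightarrow> real vec"
    \<comment> \<open>The invariant of the label row: residuals for the loss with \<open>+ y\<close>
      on the context, the bare prediction at the query.\<close>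
    define lab where "lab c x l j = poly_fun d p (bcd (icl_loss d p n x (y c x)) \<eta> b l) (x j) +
      (if j < n then y c x j else 0)" for c x l j
    \<comment> \<open>Before the first block the register holds 0, which is no monomial value; since
      \<open>a 0\<close> is constant, the first block resets it.\<close>
    define s where "s x l j = (if l = 0 then 0 else monomial_val (a (l - 1)) (x j))"
      for x :: "nat \<Rightarrow> real vec" and l j :: nat
    have bilin': "tf_state n TF Z (2 * l + 1) = emb_state d n x (\<lambda>j. monomial_val (a l) (x j)) g"
      if "tf_state n TF Z (2 * l) = emb_state d n x (s x l) g" "l < L" for Z l x g
    proof -
      have "a l = replicate d 0 \<or> s x l = (\<lambda>j. monomial_val (a (l - 1)) (x j))"
        using a0 by (cases l) (auto simp: s_def)
      from bilin[OF this, of g] show ?thesis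
        using that by (simp add: TF Let_def)
    qed
    have even: "tf_state n TF (poly_prompt d p (2 * d + 1) n x c) (2 * l)
        = emb_state d n x (s x l) (lab c x l)" if "l \<le> L" for x c l
      using that
    proof (induction l)
      case 0
      \<comment> \<open>The zero initial coefficients make the prompt's label row satisfy the
        invariant.\<close>
      have "lab c x 0 = (\<lambda>j. if j < n then y c x j else 0)"
        by (auto simp: lab_def poly_fun_def)
      then show ?case
        unfolding poly_prompt_def prompt_eq_emb_state[OF assms(1)] y_def by (simp add: s_def)
    next
      case (Suc l)
      have "tf_state n TF (poly_prompt d p (2 * d + 1) n x c) (2 * l + 1)
          = emb_state d n x (\<lambda>j. monomial_val (a l) (x j)) (lab c x l)"
        using Suc by (intro bilin') auto
      then have "tf_state n TF (poly_prompt d p (2 * d + 1) n x c) (2 * Suc l)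
          = attn n (blk_P (blk l)) (blk_Q (blk l))
            (emb_state d n x (\<lambda>j. monomial_val (a l) (x j)) (lab c x l))"
        using Suc by (simp add: Let_def TF)
      also have "\<dots> = emb_state d n x (s x (Suc l)) (lab c x (Suc l))"
        \<comment> \<open>Attention weights the kernel by the residuals in \<open>lab\<close>,
          exactly as \<open>poly_fun_bcd_Suc\<close> does; \<open>bcd.simps\<close> is withheld so
          that this rule can match.\<close>
        unfolding attn
        by (rule arg_cong2[where f = "emb_state d n x"])
          (auto simp: s_def lab_def poly_fun_bcd_Suc[OF b_mon] simp del: bcd.simps)
      finally show ?case .
    qed
    have feat: "b l = bilin_features d p (2 * d + 1) n TF l" if l: "l \<in> {1..L}" for l
    proof -
      obtain k where k: "l = Suc k" "k < L" using l by (cases l) auto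
      have odd: "tf_state n TF (poly_prompt d p (2 * d + 1) n x c) (2 * l - 1)
          = emb_state d n x (\<lambda>j. monomial_val (a k) (x j)) (lab c x k)" for x c
        using bilin'[OF even] k by simp
      have "q \<in> row_feature d (a k) ` {..Suc d} \<longleftrightarrow>
          (\<exists>r<2 * d + 1. \<forall>x c. (\<forall>j\<le>n. x j \<in> carrier_vec d) \<longrightarrow>
            (\<forall>j\<le>n. emb_state d n x (\<lambda>j. monomial_val (a k) (x j)) (lab c x k) $$ (r, j)
              = monomial_val q (x j)))" if "q \<in> monomials d p" for q
      proof -
        \<comment> \<open>Rows above the label row do not depend on the labels, hence not on
          \<open>c\<close>, so zero labels may stand in for \<open>lab c x k\<close>.\<close>
        have "emb_state d n x (\<lambda>j. monomial_val (a k) (x j)) (lab c x k) $$ (r, j)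
            = emb_state d n x (\<lambda>j. monomial_val (a k) (x j)) (\<lambda>_. 0) $$ (r, j)"
          if "r < 2 * d + 1" "j \<le> n" for x c r j
          using that by (simp add: emb_state_def)
        then show ?thesis
          using that row_feature_iff[OF assms(1) a[of k], of q n "\<lambda>_. 0"]
          by (simp add: monomials_def cong: conj_cong)
      qed
      then show ?thesis
        unfolding bilin_features_def odd by (auto simp: b_def k)
    qed
    show ?thesis
    proof (intro exI conjI ballI allI impI)
      show "bilinear_transformer (2 * d + 1) L TF"
        using blk by (auto simp: bilinear_transformer_def TF_def implements_step_def)
    next
      fix \<omega> l assume "l \<le> L"
      then have "tf_state n TF (poly_prompt d p (2 * d + 1) n (\<lambda>i. X i \<omega>) (\<lambda>q. C q \<omega>)) (2 * l)
          $$ (2 * d + 1, n) = lab (\<lambda>q. C q \<omega>) (\<lambda>i. X i \<omega>) l n"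
        using assms(1) unfolding even[OF \<open>l \<le> L\<close>] by (simp add: emb_state_def)
      \<comment> \<open>Column \<open>n\<close> lies outside the context, so the \<open>y\<close>
        term of \<open>lab\<close> vanishes and the prediction remains.\<close>
      then show "tf_state n TF (poly_prompt d p (2 * d + 1) n (\<lambda>i. X i \<omega>) (\<lambda>q. C q \<omega>)) (2 * l)
            $$ (2 * d + 1, n)
          = poly_fun d p
              (bcd (icl_loss d p n (\<lambda>i. X i \<omega>)
                     (\<lambda>i. poly_fun d p (\<lambda>q. C q \<omega>) (X i \<omega>))) \<eta> b l)
              (X n \<omega>)"
        by (simp add: lab_def y_def)
    qed (rule feat)
  qed
  ultimately show ?thesis by blast
qed

end
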